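(* Let $\alpha\in(0,1)$ and let $\{x_{i}\}_{i=1}^{\infty}$ be any countable subset of $SU(2)$. Then there exists a function $f\in\mathrm{Lip}_{\alpha}(SU(2))$ such that $$\sup_{N\geq1}|S_{N}f(x_{i})|=\infty$$ for all $i=1,2,3,\ldots$.
   Context: $SU(2)$ is equipped with its normalized Haar measure $\mu$ and with the bi-invariant metric $d(x,y)=\sqrt{\tfrac12\mathrm{tr}\big((x-y)(x-y)^{*}\big)}$. For $0<\alpha<1$, $\mathrm{Lip}_\alpha(SU(2))$ is the set of real functions $f$ on $SU(2)$ for which there is $M>0$ with $|f(x)-f(y)|\le M\,d(x,y)^{\alpha}$ for all $x,y\in SU(2)$. For $n=0,1,2,\dots$, let $\chi_n$ be the character of the (unique up to equivalence) continuous irreducible unitary representation of $SU(2)$ of dimension $n+1$; explicitly $\chi_n(x)=\frac{\sin((n+1)\theta)}{\sin\theta}$ where $e^{\pm i\theta}$ are the eigenvalues of $x$ (extended by continuity when $\sin\theta=0$). The Fourier partial sums of $f$ are $$S_Nf(x)=\sum_{n=0}^{N}(n+1)(\chi_n\ast f)(x),\qquad (g\ast f)(x)=\int_{SU(2)}g(y)f(y^{-1}x)\,d\mu(y).$$ *)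

theory Defs
  imports "HOL-Analysis.Analysis"
begin

definition conj_transpose :: "complex^'n^'m \<Rightarrow> complex^'m^'n" where
  "conj_transpose A = (\<chi> i j. cnj (A $ j $ i))"

definition SU2 :: "(complex^2^2) set" where
  "SU2 = {x. x ** conj_transpose x = mat 1 \<and> det x = 1}"

definition SU2_dist :: "complex^2^2 \<Rightarrow> complex^2^2 \<Rightarrow> real" where
  "SU2_dist x y = sqrt (Re (trace ((x - y) ** conj_transpose (x - y))) / 2)"

(* Functions on SU(2) are functions on all complex 2x2 matrices of which only the values
   on SU2 are ever used. *)
definition Lip :: "real \<Rightarrow> (complex^2^2 \<Rightarrow> real) set" where
  "Lip \<alpha> = {f. \<exists>M>0. \<forall>x\<in>SU2. \<forall>y\<in>SU2. \<bar>f x - f y\<bar> \<le> M * SU2_dist x y powr \<alpha>}"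

(* The left-invariant Borel probability measure on SU2; existence and uniqueness are the
   theorem of Haar, and right invariance follows since SU(2) is compact. *)
definition is_haar_SU2 :: "(complex^2^2) measure \<Rightarrow> bool" where
  "is_haar_SU2 \<mu> \<longleftrightarrow> emeasure \<mu> SU2 = 1 \<and> sets \<mu> = sets (restrict_space borel SU2) \<and>
     (\<forall>g\<in>SU2. \<forall>A\<in>sets \<mu>. emeasure \<mu> ((\<lambda>x. g ** x) ` A) = emeasure \<mu> A)"

definition eigenvalues :: "complex^'n^'n \<Rightarrow> complex set" where
  "eigenvalues x = {c. \<exists>v. v \<noteq> 0 \<and> x *v v = c *s v}"

(* The angle is normalised to [0, pi], which makes it unique (SU2_angle_ex1). *)
definition SU2_angle :: "complex^2^2 \<Rightarrow> real" where
  "SU2_angle x = (THE \<theta>. 0 \<le> \<theta> \<and> \<theta> \<le> pi \<and> eigenvalues x = {cis \<theta>, cis (- \<theta>)})"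

(* Where sin theta = 0, the value is the limit of the quotient (SU2_character_limit). *)
definition SU2_character :: "nat \<Rightarrow> complex^2^2 \<Rightarrow> real" where
  "SU2_character n x =
     (let \<theta> = SU2_angle x in
      if sin \<theta> = 0 then (real n + 1) * cos \<theta> ^ n
      else sin ((real n + 1) * \<theta>) / sin \<theta>)"

definition convolution ::
  "(complex^2^2) measure \<Rightarrow> (complex^2^2 \<Rightarrow> real) \<Rightarrow> (complex^2^2 \<Rightarrow> real) \<Rightarrow> complex^2^2 \<Rightarrow> real"
  where "convolution \<mu> g f x = (\<integral>y. g y * f (matrix_inv y ** x) \<partial>\<mu>)"

definition partial_sum ::
  "(complex^2^2) measure \<Rightarrow> nat \<Rightarrow> (complex^2^2 \<Rightarrow> real) \<Rightarrow> complex^2^2 \<Rightarrow> real"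
  where "partial_sum \<mu> N f x = (\<Sum>n=0..N. (real n + 1) * convolution \<mu> (SU2_character n) f x)"

lemma eigenvalues_iff_det:
  fixes x :: "complex^'n^'n"
  shows "c \<in> eigenvalues x \<longleftrightarrow> det (x - mat c) = 0"
proof -
  have eq: "(x - mat c) *v v = x *v v - c *s v" for v
    by (simp add: vec_eq_iff matrix_vector_mult_def mat_def left_diff_distrib sum_subtractf
        if_distrib[of "\<lambda>a. a * _"] sum.delta cong: if_cong)
  have "det (x - mat c) = 0 \<longleftrightarrow> \<not> invertible (x - mat c)"
    by (simp add: invertible_det_nz)
  also have "\<dots> \<longleftrightarrow> (\<exists>v. v \<noteq> 0 \<and> (x - mat c) *v v = 0)"
    unfolding invertible_left_inverse matrix_left_invertible_ker by auto
  finally show ?thesis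
    by (auto simp: eigenvalues_def eq)
qed

lemma SU2_eigenvalues:
  assumes "x \<in> SU2"
  shows "\<bar>Re (x $ 1 $ 1)\<bar> \<le> 1"
    and "eigenvalues x = {cis (arccos (Re (x $ 1 $ 1))), cis (- arccos (Re (x $ 1 $ 1)))}"
proof -
  define a b c d where "a = x $ 1 $ 1" and "b = x $ 1 $ 2" and "c = x $ 2 $ 1" and "d = x $ 2 $ 2"
  have "x ** conj_transpose x = mat 1" and "det x = 1"
    using assms by (auto simp: SU2_def)
  hence 1: "a * cnj a + b * cnj b = 1" and 2: "c * cnj a + d * cnj b = 0"
    and 3: "a * d - b * c = 1"
    by (auto simp: vec_eq_iff matrix_matrix_mult_def conj_transpose_def mat_def sum_2 forall_2
        det_2 a_def b_def c_def d_def)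
  have "d = d * (a * cnj a + b * cnj b)" by (simp add: 1)
  also have "\<dots> = (a * d - b * c) * cnj a + b * (c * cnj a + d * cnj b)"
    by (simp add: algebra_simps)
  finally have d: "d = cnj a" by (simp add: 2 3)
  have "(cmod a)\<^sup>2 + (cmod b)\<^sup>2 = 1"
    using arg_cong[OF 1, of Re] unfolding cmod_power2 by (simp add: power2_eq_square)
  hence "(cmod a)\<^sup>2 \<le> 1" using zero_le_power2[of "cmod b"] by linarith
  hence "cmod a \<le> 1" by (simp add: abs_square_le_1)
  thus r: "\<bar>Re (x $ 1 $ 1)\<bar> \<le> 1"
    using abs_Re_le_cmod[of a] by (simp add: a_def)
  define t where "t = arccos (Re a)"
  have t: "cos t = Re a" using r by (simp add: t_def a_def cos_arccos_abs)
  have "z \<in> eigenvalues x \<longleftrightarrow> z = cis t \<or> z = cis (- t)" for z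
  proof -
    have "det (x - mat z) = (a - z) * (d - z) - b * c"
      by (simp add: det_2 mat_def a_def b_def c_def d_def)
    also have "\<dots> = (a * d - b * c) - (a + d) * z + z * z" by (simp add: algebra_simps)
    also have "\<dots> = 1 - (a + d) * z + z * z" by (simp add: 3)
    also have "a + d = cis t + cis (- t)" by (simp add: d complex_eq_iff t)
    also have "1 - (cis t + cis (- t)) * z + z * z
        = cis t * cis (- t) - (cis t + cis (- t)) * z + z * z" by (simp add: cis_mult)
    also have "\<dots> = (z - cis t) * (z - cis (- t))" by (simp add: algebra_simps)
    finally show ?thesis by (simp add: eigenvalues_iff_det)
  qed
  thus "eigenvalues x = {cis (arccos (Re (x $ 1 $ 1))), cis (- arccos (Re (x $ 1 $ 1)))}"
    by (auto simp: t_def a_def)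
qed

lemma SU2_angle_ex1:
  assumes "x \<in> SU2"
  shows "\<exists>!\<theta>. 0 \<le> \<theta> \<and> \<theta> \<le> pi \<and> eigenvalues x = {cis \<theta>, cis (- \<theta>)}"
proof (rule ex1I)
  let ?t = "arccos (Re (x $ 1 $ 1))"
  show t: "0 \<le> ?t \<and> ?t \<le> pi \<and> eigenvalues x = {cis ?t, cis (- ?t)}"
    using SU2_eigenvalues[OF assms] by (auto simp: arccos_lbound arccos_ubound)
  fix \<theta> assume th: "0 \<le> \<theta> \<and> \<theta> \<le> pi \<and> eigenvalues x = {cis \<theta>, cis (- \<theta>)}"
  hence "cis \<theta> = cis ?t \<or> cis \<theta> = cis (- ?t)" using t by auto
  hence "cos \<theta> = cos ?t" by (auto simp: complex_eq_iff)
  thus "\<theta> = ?t" using th t by (metis arccos_cos)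
qed

lemma SU2_angle_eq:
  assumes "x \<in> SU2"
  shows "SU2_angle x = arccos (Re (x $ 1 $ 1))"
  unfolding SU2_angle_def
  by (rule the1_equality[OF SU2_angle_ex1[OF assms]])
     (use SU2_eigenvalues[OF assms] in \<open>auto simp: arccos_lbound arccos_ubound\<close>)

lemma SU2_character_limit:
  assumes "sin \<theta> = 0"
  shows "((\<lambda>t. sin ((real n + 1) * t) / sin t) \<longlongrightarrow> (real n + 1) * cos \<theta> ^ n) (at \<theta>)"
proof -
  have c: "sin (real k * \<theta>) = 0 \<and> cos (real k * \<theta>) = cos \<theta> ^ k" for k
    by (induction k) (auto simp: distrib_right sin_add cos_add assms)
  have cs: "cos \<theta> \<noteq> 0" using sin_cos_squared_add[of \<theta>] assms by auto
  let ?m = "real n + 1"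
  have sk: "sin (?m * \<theta>) = 0" and ck: "cos (?m * \<theta>) = cos \<theta> ^ Suc n"
    using c[of "Suc n"] by (auto simp: add.commute)
  have "((\<lambda>t. sin (?m * t)) has_field_derivative ?m * cos (?m * \<theta>)) (at \<theta>)"
    by (auto intro!: derivative_eq_intros)
  hence A: "((\<lambda>t. sin (?m * t) / (t - \<theta>)) \<longlongrightarrow> ?m * cos (?m * \<theta>)) (at \<theta>)"
    by (simp add: has_field_derivative_iff sk)
  have "(sin has_field_derivative cos \<theta>) (at \<theta>)"
    by (auto intro!: derivative_eq_intros)
  hence B: "((\<lambda>t. sin t / (t - \<theta>)) \<longlongrightarrow> cos \<theta>) (at \<theta>)"
    by (simp add: has_field_derivative_iff assms)
  have "((\<lambda>t. (sin (?m * t) / (t - \<theta>)) / (sin t / (t - \<theta>)))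
      \<longlongrightarrow> (?m * cos (?m * \<theta>)) / cos \<theta>) (at \<theta>)"
    by (rule tendsto_divide[OF A B cs])
  also have "(?m * cos (?m * \<theta>)) / cos \<theta> = ?m * cos \<theta> ^ n"
    using cs by (simp add: ck)
  finally show ?thesis
    by (rule Lim_transform_eventually) (auto simp: eventually_at_filter)
qed

end

(* Writing U_n for the Chebyshev polynomials of the second kind and u = cos \<theta> for half the trace,
   chi_n = U_n(u) and 2 cos (k+2)\<theta> = U_(k+2)(u) - U_k(u).  Hence S_(k+1) of the latter at the identity is
   -(k+1), while its Lip_\<alpha> norm is O(k^\<alpha>); as \<alpha> < 1, point evaluations of S_N are not uniformly bounded
   on Lip_\<alpha>.  A gliding hump over translates of these functions, visiting every x_i infinitely
   often, yields one f that diverges at all the x_i.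

   The orthogonality needed is \<integral> U_n(u) d\<mu> = 0 for n \<ge> 1.  Left invariance under the three one-parameter
   groups of rotations gives Stein's identity \<integral> 3 u p(u) - (1 - u^2) p'(u) d\<mu> = 0, and p = U_(n+1) turns
   it into a two-term recurrence for the integrals. *)
theory Submission
  imports Defs
    "HOL-Probability.Probability_Measure"
    "HOL-Computational_Algebra.Polynomial"
    "HOL-Library.Nat_Bijection"
    "HOL-Real_Asymp.Real_Asymp"
begin

section \<open>Chebyshev polynomials of the second kind\<close>

fun cheb :: "nat \<Rightarrow> real poly" where
  "cheb 0 = 1"
| "cheb (Suc 0) = [:0, 2:]"
| "cheb (Suc (Suc n)) = [:0, 2:] * cheb (Suc n) - cheb n"

lemma poly_cheb_Suc_Suc:
  "poly (cheb (Suc (Suc n))) u = 2 * u * poly (cheb (Suc n)) u - poly (cheb n) u"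
  by simp

declare cheb.simps(3) [simp del]

lemma poly_cheb_sin: "poly (cheb n) (cos t) * sin t = sin ((real n + 1) * t)"
proof (induction n rule: cheb.induct)
  case (3 n)
  have "poly (cheb (Suc (Suc n))) (cos t) * sin t
      = 2 * cos t * sin ((real n + 2) * t) - sin ((real n + 1) * t)"
    using 3 by (simp add: poly_cheb_Suc_Suc algebra_simps)
  also have "sin ((real n + 1) * t) = sin ((real n + 2) * t - t)"
    by (simp add: algebra_simps)
  also have "2 * cos t * sin ((real n + 2) * t) - \<dots> = sin ((real n + 2) * t + t)"
    unfolding sin_add sin_diff by (simp add: algebra_simps)
  also have "(real n + 2) * t + t = (real (Suc (Suc n)) + 1) * t"
    by (simp add: algebra_simps)
  finally show ?case .
next
  case 2
  then show ?case using sin_double[of t] by (simp add: mult.commute mult.left_commute)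
qed simp

text \<open>Covers the points where \<open>sin t = 0\<close> and \<open>poly_cheb_sin\<close> gives
  no information: there \<open>u ^ (n + 2) = u ^ n\<close>, and the recurrence becomes
  \<open>2 (n + 2) - (n + 1) = n + 3\<close>.\<close>

lemma poly_cheb_pm1:
  assumes "u\<^sup>2 = 1"
  shows "poly (cheb n) u = (real n + 1) * u ^ n"
proof (induction n rule: cheb.induct)
  case (3 n)
  have "poly (cheb (Suc (Suc n))) u = (2 * (real n + 2)) * (u * u ^ Suc n) - (real n + 1) * u ^ n"
    using 3 by (simp add: poly_cheb_Suc_Suc)
  also have "u * u ^ Suc n = u ^ n"
    using assms by (simp add: power2_eq_square mult.assoc[symmetric])
  also have "(2 * (real n + 2)) * u ^ n - (real n + 1) * u ^ n = (real n + 3) * u ^ n"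
    by (simp add: algebra_simps)
  also have "u ^ n = u ^ Suc (Suc n)"
    using assms by (simp add: power2_eq_square mult.assoc[symmetric])
  finally show ?case by simp
qed simp_all

text \<open>Comes from \<open>sin (A + B) - sin (A - B) = 2 cos A sin B\<close> after division by
  \<open>sin t\<close>, and from the endpoint values where \<open>sin t = 0\<close>. This form
  supplies the size and Hoelder bounds for \<open>osc\<close>.\<close>

lemma poly_cheb_diff_cos: "poly (cheb (Suc (Suc k)) - cheb k) (cos t) = 2 * cos (real (k + 2) * t)"
proof (cases "sin t = 0")
  case True
  have u: "(cos t)\<^sup>2 = 1" using sin_cos_squared_add[of t] True by simp
  have c: "sin (real j * t) = 0 \<and> cos (real j * t) = cos t ^ j" for j
    by (induction j) (auto simp: distrib_right sin_add cos_add True)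
  have e: "cos t ^ Suc (Suc k) = cos t ^ k"
    using u by (simp add: power2_eq_square mult.assoc[symmetric])
  have "poly (cheb (Suc (Suc k)) - cheb k) (cos t)
      = (real k + 3) * cos t ^ Suc (Suc k) - (real k + 1) * cos t ^ k"
    unfolding poly_diff poly_cheb_pm1[OF u] by (simp add: algebra_simps)
  also have "\<dots> = 2 * cos t ^ Suc (Suc k)" unfolding e by (simp add: algebra_simps)
  also have "cos t ^ Suc (Suc k) = cos (real (k + 2) * t)"
    using c[of "k + 2"] by (simp add: algebra_simps)
  finally show ?thesis .
next
  case False
  have "poly (cheb (Suc (Suc k)) - cheb k) (cos t) * sin t
      = sin (real (k + 2) * t + t) - sin (real (k + 2) * t - t)"
    unfolding poly_diff left_diff_distrib poly_cheb_sin by (simp add: algebra_simps)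
  also have "\<dots> = (2 * cos (real (k + 2) * t)) * sin t"
    unfolding sin_add sin_diff by (simp add: algebra_simps)
  finally show ?thesis using False by simp
qed

text \<open>The factor \<open>1 - u\<^sup>2\<close> is the one in \<open>stein_identity\<close>,
  which thereby loses its derivative. The induction differentiates the recurrence and uses the
  formula at the two lower indices.\<close>

lemma poly_cheb_pderiv:
  "(1 - u\<^sup>2) * poly (pderiv (cheb (Suc n))) u
     = (real n + 2) * poly (cheb n) u - (real n + 1) * u * poly (cheb (Suc n)) u"
proof (induction n rule: less_induct)
  case (less n)
  show ?case
  proof (cases n)
    case 0
    then show ?thesis by (simp add: power2_eq_square pderiv_pCons algebra_simps)
  next
    case (Suc k)
    let ?U = "\<lambda>j. poly (cheb j) u" and ?D = "\<lambda>j. poly (pderiv (cheb j)) u"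
    have D: "?D (Suc n) = 2 * ?U n + 2 * u * ?D n - ?D k"
      unfolding Suc cheb.simps(3)
      by (simp add: pderiv_diff pderiv_mult pderiv_pCons pderiv_smult algebra_simps)
    have 1: "(1 - u\<^sup>2) * ?D n = (real k + 2) * ?U k - (real k + 1) * u * ?U n"
      using less.IH[of k] Suc by simp
    \<comment> \<open>\<open>U_(k-1)\<close> is written as \<open>2 u U_k - U_(k+1)\<close>, so that
      k = 0, where the index would be -1, has the same form.\<close>
    have 2: "(1 - u\<^sup>2) * ?D k = (real k + 1) * (2 * u * ?U k - ?U n) - real k * u * ?U k"
    proof (cases k)
      case 0
      then show ?thesis using Suc by simp
    next
      case (Suc l)
      have "?U l = 2 * u * ?U k - ?U n"
        using Suc \<open>n = Suc k\<close> by (simp add: poly_cheb_Suc_Suc)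
      moreover have "(1 - u\<^sup>2) * ?D k = (real k + 1) * ?U l - real k * u * ?U k"
        using less.IH[of l] Suc \<open>n = Suc k\<close> by (simp add: add.commute)
      ultimately show ?thesis by simp
    qed
    have 3: "?U (Suc n) = 2 * u * ?U n - ?U k"
      unfolding Suc by (rule poly_cheb_Suc_Suc)
    have "(1 - u\<^sup>2) * ?D (Suc n)
        = 2 * (1 - u\<^sup>2) * ?U n + 2 * u * ((1 - u\<^sup>2) * ?D n) - (1 - u\<^sup>2) * ?D k"
      unfolding D by (simp add: algebra_simps)
    also have "\<dots> = (real n + 2) * ?U n - (real n + 1) * u * ?U (Suc n)"
      unfolding 1 2 3 by (simp add: Suc algebra_simps power2_eq_square)
    finally show ?thesis .
  qed
qed

text \<open>For u = cos t this is \<open>2 cos A sin B = sin (A + B) - sin (A - B)\<close> with A =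
  (k + 2) t and B = (n + 1) t, divided by \<open>sin t\<close>. Only n = k produces the constant
  \<open>cheb 0\<close>, the one term with nonzero mean.\<close>

lemma poly_cheb_mult:
  assumes "n \<le> k"
  shows "poly (cheb (Suc (Suc k)) - cheb k) u * poly (cheb n) u
     = poly (cheb (n + k + 2)) u - poly (cheb (k - n)) u"
  using assms
proof (induction n rule: cheb.induct)
  case 2
  then obtain l where "k = Suc l" by (cases k) auto
  then show ?case by (simp add: poly_cheb_Suc_Suc algebra_simps)
next
  case (3 n)
  then obtain l where l: "k = n + l + 2" by (metis add_Suc_right add_Suc nat_le_iff_add add_2_eq_Suc')
  have a: "k - n = Suc (Suc l)" "k - Suc n = Suc l" "k - Suc (Suc n) = l" using l by auto
  let ?V = "poly (cheb (Suc (Suc k)) - cheb k) u"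
  have "?V * poly (cheb (Suc (Suc n))) u
      = 2 * u * (?V * poly (cheb (Suc n)) u) - ?V * poly (cheb n) u"
    unfolding poly_cheb_Suc_Suc[of n] by (simp only: algebra_simps)
  also have "\<dots> = 2 * u * (poly (cheb (Suc n + k + 2)) u - poly (cheb (Suc l)) u)
      - (poly (cheb (n + k + 2)) u - poly (cheb (Suc (Suc l))) u)"
    using 3 by (simp add: a del: poly_diff)
  also have "\<dots> = poly (cheb (Suc (Suc n) + k + 2)) u - poly (cheb l) u"
    by (simp add: poly_cheb_Suc_Suc algebra_simps)
  finally show ?case by (simp add: a)
qed simp_all

text \<open>The case n = k + 1 of the product formula: the subtracted term is
  \<open>U_(-1) = 0\<close>, whereas truncated subtraction in \<open>cheb (k - n)\<close> would give
  \<open>cheb 0 = 1\<close>.\<close>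

lemma poly_cheb_mult_Suc:
  "poly (cheb (Suc (Suc k)) - cheb k) u * poly (cheb (Suc k)) u = poly (cheb (2 * k + 3)) u"
proof (cases k)
  case 0
  then show ?thesis by (simp add: poly_cheb_Suc_Suc numeral_eq_Suc algebra_simps)
next
  case (Suc l)
  let ?V = "poly (cheb (Suc (Suc k)) - cheb k) u"
  have "?V * poly (cheb (Suc k)) u = 2 * u * (?V * poly (cheb k) u) - ?V * poly (cheb l) u"
    unfolding Suc poly_cheb_Suc_Suc[of l] by (simp only: algebra_simps)
  also have "\<dots> = 2 * u * (poly (cheb (k + k + 2)) u - 1) - (poly (cheb (l + k + 2)) u - 2 * u)"
    using poly_cheb_mult[of k k u] poly_cheb_mult[of l k u] Suc by simp
  also have "\<dots> = 2 * u * poly (cheb (Suc (l + k + 2))) u - poly (cheb (l + k + 2)) u"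
    using Suc by (simp add: algebra_simps)
  also have "\<dots> = poly (cheb (2 * k + 3)) u"
    using Suc by (simp add: poly_cheb_Suc_Suc numeral_eq_Suc)
  finally show ?thesis .
qed

section \<open>SU(2) as the unit sphere of the quaternions\<close>

lemma SU2_entries:
  assumes "y \<in> SU2"
  shows "y $ 2 $ 2 = cnj (y $ 1 $ 1)" "y $ 2 $ 1 = - cnj (y $ 1 $ 2)"
    and "(cmod (y $ 1 $ 1))\<^sup>2 + (cmod (y $ 1 $ 2))\<^sup>2 = 1"
proof -
  define a b c d where "a = y $ 1 $ 1" and "b = y $ 1 $ 2" and "c = y $ 2 $ 1" and "d = y $ 2 $ 2"
  have "y ** conj_transpose y = mat 1" and "det y = 1"
    using assms by (auto simp: SU2_def)
  hence 1: "a * cnj a + b * cnj b = 1" and 2: "c * cnj a + d * cnj b = 0"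
    and 3: "a * d - b * c = 1"
    by (auto simp: vec_eq_iff matrix_matrix_mult_def conj_transpose_def mat_def sum_2 forall_2
        det_2 a_def b_def c_def d_def)
  \<comment> \<open>Multiplying by \<open>1 = a * cnj a + b * cnj b\<close> and regrouping brings
    out the determinant and the orthogonality of the rows.\<close>
  have "d = d * (a * cnj a + b * cnj b)" by (simp add: 1)
  also have "\<dots> = (a * d - b * c) * cnj a + b * (c * cnj a + d * cnj b)"
    by (simp add: algebra_simps)
  finally show "y $ 2 $ 2 = cnj (y $ 1 $ 1)" by (simp only: 2 3, simp add: a_def d_def)
  have "c = c * (a * cnj a + b * cnj b)" by (simp add: 1)
  also have "\<dots> = a * (c * cnj a + d * cnj b) - (a * d - b * c) * cnj b"
    by (simp add: algebra_simps)
  finally show "y $ 2 $ 1 = - cnj (y $ 1 $ 2)" by (simp only: 2 3, simp add: c_def b_def)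
  have "complex_of_real ((cmod a)\<^sup>2 + (cmod b)\<^sup>2) = 1"
    using 1 by (simp only: complex_norm_square of_real_add)
  then show "(cmod (y $ 1 $ 1))\<^sup>2 + (cmod (y $ 1 $ 2))\<^sup>2 = 1"
    unfolding a_def b_def of_real_eq_1_iff .
qed

text \<open>Quaternions in complex coordinates. Arbitrary a and b are allowed, so that differences
  of elements of \<open>SU2\<close> have this form as well.\<close>

definition quat :: "complex \<Rightarrow> complex \<Rightarrow> complex^2^2" where
  "quat a b = vector [vector [a, b], vector [- cnj b, cnj a]]"

lemma quat_entries [simp]:
  "quat a b $ 1 $ 1 = a" "quat a b $ 1 $ 2 = b" "quat a b $ 2 $ 1 = - cnj b" "quat a b $ 2 $ 2 = cnj a"
  by (simp_all add: quat_def)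

lemma SU2_iff: "y \<in> SU2 \<longleftrightarrow> (\<exists>a b. y = quat a b \<and> (cmod a)\<^sup>2 + (cmod b)\<^sup>2 = 1)"
proof
  assume "y \<in> SU2"
  from SU2_entries[OF this] show "\<exists>a b. y = quat a b \<and> (cmod a)\<^sup>2 + (cmod b)\<^sup>2 = 1"
    by (intro exI[of _ "y $ 1 $ 1"] exI[of _ "y $ 1 $ 2"]) (simp add: vec_eq_iff forall_2)
next
  assume "\<exists>a b. y = quat a b \<and> (cmod a)\<^sup>2 + (cmod b)\<^sup>2 = 1"
  then obtain a b where y: "y = quat a b" and n: "(cmod a)\<^sup>2 + (cmod b)\<^sup>2 = 1" by blast
  have "a * cnj a + b * cnj b = complex_of_real ((cmod a)\<^sup>2 + (cmod b)\<^sup>2)"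
    by (simp only: complex_norm_square of_real_add)
  also have "\<dots> = 1" using n by simp
  finally have e: "a * cnj a + b * cnj b = 1" .
  then have "cnj a * a + cnj b * b = 1" by (simp only: mult.commute)
  with e show "y \<in> SU2"
    by (simp add: y SU2_def vec_eq_iff forall_2 matrix_matrix_mult_def conj_transpose_def
        mat_def sum_2 det_2 mult.commute add.commute)
qed

lemma conj_transpose_mult: "conj_transpose (A ** B) = conj_transpose B ** conj_transpose A"
  by (simp add: conj_transpose_def matrix_matrix_mult_def vec_eq_iff cnj_sum mult.commute)

lemma SU2_mult: "g \<in> SU2 \<Longrightarrow> h \<in> SU2 \<Longrightarrow> g ** h \<in> SU2"
proof -
  assume g: "g \<in> SU2" and h: "h \<in> SU2"
  have "(g ** h) ** conj_transpose (g ** h) = g ** (h ** conj_transpose h) ** conj_transpose g"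
    by (simp only: conj_transpose_mult matrix_mul_assoc)
  also have "\<dots> = mat 1" using g h by (simp add: SU2_def)
  finally show ?thesis using g h by (simp add: SU2_def det_mul)
qed

lemma SU2_conj_transpose:
  assumes "g \<in> SU2"
  shows "conj_transpose g \<in> SU2" "conj_transpose g ** g = mat 1" "g ** conj_transpose g = mat 1"
    "matrix_inv g = conj_transpose g"
proof -
  show 1: "g ** conj_transpose g = mat 1" using assms by (simp add: SU2_def)
  show 2: "conj_transpose g ** g = mat 1" using 1 matrix_left_right_inverse by blast
  have "det (conj_transpose g) = cnj (det g)" by (simp add: det_2 conj_transpose_def)
  moreover have "conj_transpose (conj_transpose g) = g"
    by (simp add: conj_transpose_def vec_eq_iff)
  ultimately show "conj_transpose g \<in> SU2" using 2 assms by (simp add: SU2_def)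
  have "matrix_inv g ** g = mat 1"
    unfolding matrix_inv_def by (rule someI2[of _ "conj_transpose g"]) (simp_all add: 1 2)
  then have "matrix_inv g ** g ** conj_transpose g = conj_transpose g" by simp
  then show "matrix_inv g = conj_transpose g" by (simp add: matrix_mul_assoc[symmetric] 1)
qed

text \<open>\<open>Re (y $ 1 $ 1)\<close> is half the trace, the cosine of the angle. Characters
  become polynomials in it, hence continuous; the convention at \<open>sin \<theta> = 0\<close>
  matches \<open>poly_cheb_pm1\<close>.\<close>

lemma SU2_character_eq:
  assumes "y \<in> SU2"
  shows "SU2_character n y = poly (cheb n) (Re (y $ 1 $ 1))"
proof -
  let ?u = "Re (y $ 1 $ 1)" and ?t = "arccos (Re (y $ 1 $ 1))"
  have c: "cos ?t = ?u" using SU2_eigenvalues(1)[OF assms] by (simp add: cos_arccos_abs)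
  show ?thesis
  proof (cases "sin ?t = 0")
    case True
    then have "?u\<^sup>2 = 1" using sin_cos_squared_add[of ?t] c by simp
    with True c show ?thesis
      by (simp add: SU2_character_def SU2_angle_eq[OF assms] poly_cheb_pm1)
  next
    case False
    with poly_cheb_sin[of n ?t] c show ?thesis
      by (simp add: SU2_character_def SU2_angle_eq[OF assms] Let_def nonzero_divide_eq_eq)
  qed
qed

lemma trace_quat_conj_transpose:
  "trace (quat a b ** conj_transpose (quat a b)) = complex_of_real (2 * ((cmod a)\<^sup>2 + (cmod b)\<^sup>2))"
proof -
  have "trace (quat a b ** conj_transpose (quat a b)) = 2 * (a * cnj a + b * cnj b)"
    by (simp add: trace_def matrix_matrix_mult_def conj_transpose_def sum_2 mult.commute)
  also have "a * cnj a + b * cnj b = complex_of_real ((cmod a)\<^sup>2 + (cmod b)\<^sup>2)"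
    by (simp only: complex_norm_square of_real_add)
  finally show ?thesis by simp
qed

text \<open>The factor 1/2 in the metric makes it the Euclidean distance of C^2, in which
  \<open>SU2\<close> is the unit sphere.\<close>

lemma SU2_dist_quat:
  "SU2_dist (quat a b) (quat c d) = sqrt ((cmod (a - c))\<^sup>2 + (cmod (b - d))\<^sup>2)"
proof -
  have "quat a b - quat c d = quat (a - c) (b - d)" by (simp add: vec_eq_iff forall_2)
  then show ?thesis unfolding SU2_dist_def by (simp only: trace_quat_conj_transpose) simp
qed

lemma poly_bounded_interval: "\<exists>B. \<forall>u::real. \<bar>u\<bar> \<le> 1 \<longrightarrow> \<bar>poly p u\<bar> \<le> B"
proof -
  have "compact (poly p ` {-1..1})"
    by (intro compact_continuous_image continuous_intros compact_Icc)
  then obtain B where "\<And>v. v \<in> poly p ` {-1..1} \<Longrightarrow> norm v \<le> B"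
    by (meson compact_imp_bounded bounded_iff)
  then show ?thesis by (intro exI[of _ B]) (auto simp: abs_le_iff)
qed

lemma continuous_on_matrix_mult [continuous_intros]:
  fixes f g :: "'a::topological_space \<Rightarrow> complex^2^2"
  assumes "continuous_on S f" "continuous_on S g"
  shows "continuous_on S (\<lambda>y. f y ** g y)"
  unfolding matrix_matrix_mult_def using assms by (intro continuous_intros)

lemma continuous_on_conj_transpose [continuous_intros]:
  fixes f :: "'a::topological_space \<Rightarrow> complex^2^2"
  assumes "continuous_on S f"
  shows "continuous_on S (\<lambda>y. conj_transpose (f y))"
  unfolding conj_transpose_def using assms by (intro continuous_intros)

lemma quat_in_SU2: "(cmod a)\<^sup>2 + (cmod b)\<^sup>2 = 1 \<Longrightarrow> quat a b \<in> SU2"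
  using SU2_iff by blast

section \<open>Haar integration, Stein's identity and the means of the characters\<close>

locale haar_SU2 =
  fixes \<mu> :: "(complex^2^2) measure"
  assumes haar: "is_haar_SU2 \<mu>"
begin

lemma sets_haar: "sets \<mu> = sets (restrict_space borel SU2)"
  using haar by (simp add: is_haar_SU2_def)

lemma space_haar: "space \<mu> = SU2"
  using sets_eq_imp_space_eq[OF sets_haar] by (simp add: space_restrict_space)

sublocale prob_space \<mu>
  by (rule prob_spaceI) (use haar in \<open>simp add: is_haar_SU2_def space_haar\<close>)

lemma borel_measurable_continuous_on_SU2:
  "continuous_on SU2 f \<Longrightarrow> f \<in> borel_measurable \<mu>"
  using borel_measurable_continuous_on_restrict[of SU2 f]
  by (simp cong: measurable_cong_sets add: measurable_cong_sets[OF sets_haar refl])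

lemma measurable_continuous_SU2:
  assumes "continuous_on SU2 f" "\<And>y. y \<in> SU2 \<Longrightarrow> f y \<in> SU2"
  shows "f \<in> measurable \<mu> \<mu>"
proof -
  have "f \<in> measurable \<mu> (restrict_space borel SU2)"
    using assms by (intro measurable_restrict_space2 borel_measurable_continuous_on_SU2)
      (auto simp: space_haar)
  then show ?thesis by (simp add: measurable_cong_sets[OF refl sets_haar])
qed

lemma measurable_left_mult: "g \<in> SU2 \<Longrightarrow> (\<lambda>y. g ** y) \<in> measurable \<mu> \<mu>"
  by (rule measurable_continuous_SU2) (auto intro!: continuous_intros SU2_mult)

text \<open>Invariance is given for images of sets, while \<open>distr\<close> needs preimages: the
  preimage under g is the image under its inverse, the conjugate transpose.\<close>

lemma distr_left_mult:
  assumes g: "g \<in> SU2"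
  shows "distr \<mu> \<mu> (\<lambda>y. g ** y) = \<mu>"
proof (rule measure_eqI)
  fix A assume "A \<in> sets (distr \<mu> \<mu> (\<lambda>y. g ** y))"
  then have A: "A \<in> sets \<mu>" by simp
  then have sub: "A \<subseteq> SU2" using sets.sets_into_space space_haar by blast
  let ?h = "conj_transpose g"
  note h = SU2_conj_transpose[OF g]
  have "(\<lambda>y. g ** y) -` A \<inter> SU2 = (\<lambda>y. ?h ** y) ` A"
  proof (intro equalityI subsetI)
    fix y assume y: "y \<in> (\<lambda>y. g ** y) -` A \<inter> SU2"
    have "y = ?h ** (g ** y)" by (simp add: matrix_mul_assoc h)
    with y show "y \<in> (\<lambda>y. ?h ** y) ` A" by blast
  next
    fix y assume "y \<in> (\<lambda>y. ?h ** y) ` A"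
    then obtain z where z: "z \<in> A" "y = ?h ** z" by blast
    then have "g ** y = z" by (simp add: matrix_mul_assoc h)
    with z sub h(1) show "y \<in> (\<lambda>y. g ** y) -` A \<inter> SU2" by (auto intro: SU2_mult)
  qed
  moreover have "emeasure \<mu> ((\<lambda>y. ?h ** y) ` A) = emeasure \<mu> A"
    using haar h(1) A by (simp add: is_haar_SU2_def)
  ultimately show "emeasure (distr \<mu> \<mu> (\<lambda>y. g ** y)) A = emeasure \<mu> A"
    using A by (simp add: emeasure_distr measurable_left_mult[OF g] space_haar)
qed simp

lemma integral_left_mult:
  fixes f :: "complex^2^2 \<Rightarrow> real"
  assumes "g \<in> SU2" "f \<in> borel_measurable \<mu>"
  shows "(\<integral>y. f (g ** y) \<partial>\<mu>) = (\<integral>y. f y \<partial>\<mu>)"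
  using integral_distr[OF measurable_left_mult[OF assms(1)] assms(2)] distr_left_mult[OF assms(1)]
  by simp

lemma integrable_bounded_SU2:
  fixes f :: "complex^2^2 \<Rightarrow> real"
  assumes "f \<in> borel_measurable \<mu>" "\<And>y. y \<in> SU2 \<Longrightarrow> \<bar>f y\<bar> \<le> B"
  shows "integrable \<mu> f"
  using assms by (intro integrable_const_bound[of _ B]) (auto simp: space_haar)

lemma integrable_poly_entry:
  "integrable \<mu> (\<lambda>y. poly p (Re (y $ 1 $ 1)))"
proof -
  obtain B where "\<forall>u. \<bar>u\<bar> \<le> 1 \<longrightarrow> \<bar>poly p u\<bar> \<le> B" using poly_bounded_interval by blast
  then show ?thesis
    by (intro integrable_bounded_SU2[of _ B] borel_measurable_continuous_on_SU2 continuous_intros)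
       (auto simp: SU2_eigenvalues(1))
qed

text \<open>Differentiating \<open>t \<mapsto> \<integral> X (R\<^sub>t y) p (Re (R\<^sub>t y)\<^sub>1\<^sub>1) d\<mu>\<close>, which is constant, at \<open>t = 0\<close>.\<close>

lemma integral_rotation:
  fixes X :: "complex^2^2 \<Rightarrow> real" and R :: "real \<Rightarrow> complex^2^2"
  assumes X: "continuous_on SU2 X" "\<And>y. y \<in> SU2 \<Longrightarrow> \<bar>X y\<bar> \<le> 1"
    and R: "\<And>t. R t \<in> SU2"
    and RX: "\<And>t y. y \<in> SU2 \<Longrightarrow> X (R t ** y) = cos t * X y + sin t * Re (y $ 1 $ 1)"
    and Re_R: "\<And>t y. y \<in> SU2 \<Longrightarrow> Re ((R t ** y) $ 1 $ 1) = cos t * Re (y $ 1 $ 1) - sin t * X y"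
  shows "(\<integral>y. Re (y $ 1 $ 1) * poly p (Re (y $ 1 $ 1)) - (X y)\<^sup>2 * poly (pderiv p) (Re (y $ 1 $ 1)) \<partial>\<mu>) = 0"
proof -
  define F where "F = (\<lambda>y. X y * poly p (Re (y $ 1 $ 1)))"
  \<comment> \<open>The derivative of \<open>F\<close> along the rotation, under which X has
    derivative \<open>Re (y $ 1 $ 1)\<close> and the latter has derivative -X.\<close>
  define G where "G = (\<lambda>y. Re (y $ 1 $ 1) * poly p (Re (y $ 1 $ 1)) - (X y)\<^sup>2 * poly (pderiv p) (Re (y $ 1 $ 1)))"
  obtain B C where B: "\<And>u. \<bar>u\<bar> \<le> 1 \<Longrightarrow> \<bar>poly p u\<bar> \<le> B"
    and C: "\<And>u. \<bar>u\<bar> \<le> 1 \<Longrightarrow> \<bar>poly (pderiv p) u\<bar> \<le> C"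
    using poly_bounded_interval by metis
  have GB: "\<bar>G y\<bar> \<le> B + C" if y: "y \<in> SU2" for y
  proof -
    have "\<bar>Re (y $ 1 $ 1) * poly p (Re (y $ 1 $ 1))\<bar> \<le> 1 * B"
      unfolding abs_mult using y by (intro mult_mono B SU2_eigenvalues(1)) auto
    moreover have "\<bar>(X y)\<^sup>2 * poly (pderiv p) (Re (y $ 1 $ 1))\<bar> \<le> 1 * C"
      unfolding abs_mult using y X(2)[OF y]
      by (intro mult_mono C SU2_eigenvalues(1)) (auto simp: abs_square_le_1)
    ultimately show ?thesis unfolding G_def by linarith
  qed
  have FB: "\<bar>F y\<bar> \<le> B" if y: "y \<in> SU2" for y
  proof -
    have "\<bar>F y\<bar> \<le> 1 * B" unfolding F_def abs_mult
      using y by (intro mult_mono B SU2_eigenvalues(1) X(2)) auto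
    then show ?thesis by simp
  qed
  have Fm: "F \<in> borel_measurable \<mu>" and Gm: "G \<in> borel_measurable \<mu>" unfolding F_def G_def
    using X(1) by (auto intro!: borel_measurable_continuous_on_SU2 continuous_intros)
  have der: "((\<lambda>t. F (R t ** y)) has_real_derivative G (R t ** y)) (at t)" if y: "y \<in> SU2" for t y
  proof -
    have "((\<lambda>t. (cos t * X y + sin t * Re (y $ 1 $ 1)) * poly p (cos t * Re (y $ 1 $ 1) - sin t * X y))
      has_real_derivative
        (cos t * Re (y $ 1 $ 1) - sin t * X y) * poly p (cos t * Re (y $ 1 $ 1) - sin t * X y)
        - (cos t * X y + sin t * Re (y $ 1 $ 1))\<^sup>2 * poly (pderiv p) (cos t * Re (y $ 1 $ 1) - sin t * X y)) (at t)"
      by (auto intro!: derivative_eq_intros simp: power2_eq_square algebra_simps)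
    then show ?thesis unfolding F_def G_def by (simp only: RX[OF y] Re_R[OF y])
  qed
  \<comment> \<open>Step sizes 1 / (k + 1) tending to 0, since dominated convergence is applied
    along a sequence.\<close>
  define e where "e = (\<lambda>k. inverse (real (Suc k)))"
  have e: "e k > 0" for k by (simp add: e_def)
  have R0: "F (R 0 ** y) = F y" "G (R 0 ** y) = G y" if "y \<in> SU2" for y
    using RX[OF that, of 0] Re_R[OF that, of 0] by (auto simp: F_def G_def)
  let ?s = "\<lambda>k y. (F (R (e k) ** y) - F y) / e k"
  have "(\<lambda>k. \<integral>y. ?s k y \<partial>\<mu>) \<longlonglongrightarrow> (\<integral>y. G y \<partial>\<mu>)"
  proof (rule integral_dominated_convergence[where w = "\<lambda>_. B + C"])
    show "(\<lambda>y. ?s k y) \<in> borel_measurable \<mu>" for k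
      using measurable_compose[OF measurable_left_mult[OF R] Fm, of "e k"] Fm by auto
    show "AE y in \<mu>. (\<lambda>k. ?s k y) \<longlonglongrightarrow> G y"
    proof (rule AE_I2)
      fix y assume "y \<in> space \<mu>"
      then have y: "y \<in> SU2" by (simp add: space_haar)
      have "((\<lambda>h. (F (R (0 + h) ** y) - F (R 0 ** y)) / h) \<longlongrightarrow> G (R 0 ** y)) (at 0)"
        using der[OF y, of 0] by (simp only: DERIV_def)
      then have "((\<lambda>h. (F (R h ** y) - F y) / h) \<longlongrightarrow> G y) (at 0)"
        by (simp add: R0[OF y])
      moreover have "filterlim e (at 0) sequentially"
        unfolding filterlim_at e_def using LIMSEQ_inverse_real_of_nat by auto
      ultimately show "(\<lambda>k. ?s k y) \<longlonglongrightarrow> G y" by (rule filterlim_compose)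
    qed
    show "AE y in \<mu>. norm (?s k y) \<le> B + C" for k
    proof (rule AE_I2)
      fix y assume "y \<in> space \<mu>"
      then have y: "y \<in> SU2" by (simp add: space_haar)
      \<comment> \<open>By the mean value theorem each difference quotient is a value of
        \<open>G\<close> at a rotated point, hence bounded independently of k and y.\<close>
      obtain t where "F (R (e k) ** y) - F (R 0 ** y) = (e k - 0) * G (R t ** y)"
        using MVT2[OF e[of k], of "\<lambda>t. F (R t ** y)" "\<lambda>t. G (R t ** y)"] der[OF y] by blast
      then have "?s k y = G (R t ** y)" using e[of k] by (simp add: R0[OF y])
      then show "norm (?s k y) \<le> B + C" using GB[OF SU2_mult[OF R y], of t] by simp
    qed
  qed (use Gm in auto)
  moreover have "(\<integral>y. ?s k y \<partial>\<mu>) = 0" for k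
  proof -
    have i: "integrable \<mu> F" "integrable \<mu> (\<lambda>y. F (R (e k) ** y))"
      using measurable_compose[OF measurable_left_mult[OF R] Fm, of "e k"] Fm FB
      by (auto intro!: integrable_bounded_SU2[of _ B] SU2_mult R)
    then show ?thesis by (simp add: integral_left_mult[OF R Fm])
  qed
  ultimately have "(\<lambda>_. 0) \<longlonglongrightarrow> (\<integral>y. G y \<partial>\<mu>)" by (simp only:)
  then show ?thesis unfolding G_def by (simp add: LIMSEQ_const_iff)
qed

text \<open>Stein's identity for the semicircle law, which is the distribution of half the trace.\<close>

lemma stein_identity:
  "(\<integral>y. 3 * Re (y $ 1 $ 1) * poly p (Re (y $ 1 $ 1))
      - (1 - (Re (y $ 1 $ 1))\<^sup>2) * poly (pderiv p) (Re (y $ 1 $ 1)) \<partial>\<mu>) = 0"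
proof -
  let ?D = "\<lambda>X y. Re (y $ 1 $ 1) * poly p (Re (y $ 1 $ 1)) - (X y)\<^sup>2 * poly (pderiv p) (Re (y $ 1 $ 1))"
  \<comment> \<open>Together with \<open>Re (y $ 1 $ 1)\<close> these are the four Euclidean
    coordinates on the 3-sphere.\<close>
  let ?X1 = "\<lambda>y::complex^2^2. Im (y $ 1 $ 1)" and ?X2 = "\<lambda>y::complex^2^2. Re (y $ 1 $ 2)"
    and ?X3 = "\<lambda>y::complex^2^2. Im (y $ 1 $ 2)"
  have norms: "cmod (y $ 1 $ 1) \<le> 1" "cmod (y $ 1 $ 2) \<le> 1" if "y \<in> SU2" for y
  proof -
    have "(cmod (y $ 1 $ 1))\<^sup>2 \<le> 1" "(cmod (y $ 1 $ 2))\<^sup>2 \<le> 1"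
      using SU2_entries(3)[OF that] zero_le_power2[of "cmod (y $ 1 $ 1)"]
        zero_le_power2[of "cmod (y $ 1 $ 2)"] by linarith+
    then show "cmod (y $ 1 $ 1) \<le> 1" "cmod (y $ 1 $ 2) \<le> 1" by (simp_all add: abs_square_le_1)
  qed
  have bound: "\<bar>?X1 y\<bar> \<le> 1" "\<bar>?X2 y\<bar> \<le> 1" "\<bar>?X3 y\<bar> \<le> 1" if "y \<in> SU2" for y
    using norms[OF that] abs_Im_le_cmod[of "y $ 1 $ 1"] abs_Re_le_cmod[of "y $ 1 $ 2"]
      abs_Im_le_cmod[of "y $ 1 $ 2"] by linarith+
  have cont: "continuous_on SU2 ?X1" "continuous_on SU2 ?X2" "continuous_on SU2 ?X3"
    by (auto intro!: continuous_intros)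
  have int: "integrable \<mu> (?D X)" if "continuous_on SU2 X" "\<And>y. y \<in> SU2 \<Longrightarrow> \<bar>X y\<bar> \<le> 1" for X
  proof -
    obtain B C where B: "\<And>u. \<bar>u\<bar> \<le> 1 \<Longrightarrow> \<bar>poly ([:0, 1:] * p) u\<bar> \<le> B"
      and C: "\<And>u. \<bar>u\<bar> \<le> 1 \<Longrightarrow> \<bar>poly (pderiv p) u\<bar> \<le> C"
      using poly_bounded_interval by metis
    show ?thesis
    proof (rule integrable_bounded_SU2[of _ "B + C"])
      show "?D X \<in> borel_measurable \<mu>"
        using that(1) by (auto intro!: borel_measurable_continuous_on_SU2 continuous_intros)
      fix y assume y: "y \<in> SU2"
      have "\<bar>(X y)\<^sup>2 * poly (pderiv p) (Re (y $ 1 $ 1))\<bar> \<le> 1 * C"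
        unfolding abs_mult using y that(2)[OF y]
        by (intro mult_mono C SU2_eigenvalues(1)) (auto simp: abs_square_le_1)
      with B[OF SU2_eigenvalues(1)[OF y]] show "\<bar>?D X y\<bar> \<le> B + C" by simp
    qed
  qed
  \<comment> \<open>The rotations are the one-parameter groups of the three quaternion units; each
    turns the plane of \<open>Re (y $ 1 $ 1)\<close> and one further coordinate.\<close>
  have "(\<integral>y. ?D ?X1 y \<partial>\<mu>) = 0"
    by (rule integral_rotation[where R = "\<lambda>t. quat (cis t) 0"])
       (auto simp: cont bound quat_in_SU2 SU2_entries(1,2) matrix_matrix_mult_def sum_2 mult.commute)
  moreover have "(\<integral>y. ?D ?X2 y \<partial>\<mu>) = 0"
    by (rule integral_rotation[where R = "\<lambda>t. quat (complex_of_real (cos t)) (complex_of_real (sin t))"])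
       (auto simp: cont bound quat_in_SU2 SU2_entries(1,2) matrix_matrix_mult_def sum_2 mult.commute)
  moreover have "(\<integral>y. ?D ?X3 y \<partial>\<mu>) = 0"
    by (rule integral_rotation[where R = "\<lambda>t. quat (complex_of_real (cos t)) (\<i> * complex_of_real (sin t))"])
       (auto simp: cont bound quat_in_SU2 SU2_entries(1,2) matrix_matrix_mult_def sum_2 mult.commute norm_mult)
  moreover have i: "integrable \<mu> (?D ?X1)" "integrable \<mu> (?D ?X2)" "integrable \<mu> (?D ?X3)"
    by (intro int cont bound; assumption)+
  ultimately have "(\<integral>y. ?D ?X1 y + ?D ?X2 y + ?D ?X3 y \<partial>\<mu>) = 0"
    unfolding Bochner_Integration.integral_add[OF Bochner_Integration.integrable_add[OF i(1,2)] i(3)]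
      Bochner_Integration.integral_add[OF i(1,2)] by linarith
  also have "(\<integral>y. ?D ?X1 y + ?D ?X2 y + ?D ?X3 y \<partial>\<mu>)
      = (\<integral>y. 3 * Re (y $ 1 $ 1) * poly p (Re (y $ 1 $ 1))
      - (1 - (Re (y $ 1 $ 1))\<^sup>2) * poly (pderiv p) (Re (y $ 1 $ 1)) \<partial>\<mu>)"
  proof (rule Bochner_Integration.integral_cong[OF refl])
    fix y assume "y \<in> space \<mu>"
    then have e: "1 - (Re (y $ 1 $ 1))\<^sup>2 = (?X1 y)\<^sup>2 + (?X2 y)\<^sup>2 + (?X3 y)\<^sup>2"
      using SU2_entries(3)[of y] by (simp add: space_haar cmod_power2)
    show "?D ?X1 y + ?D ?X2 y + ?D ?X3 y = 3 * Re (y $ 1 $ 1) * poly p (Re (y $ 1 $ 1))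
      - (1 - (Re (y $ 1 $ 1))\<^sup>2) * poly (pderiv p) (Re (y $ 1 $ 1))"
      unfolding e by (simp add: algebra_simps)
  qed
  finally show ?thesis .
qed

text \<open>The recurrence is \<open>(n + 4) \<integral> U_(n+2) = n \<integral> U_n\<close>. The
  coefficient n = 0 cuts the even chain right after \<open>U_0\<close>; the odd chain starts from
  mean 0, which is Stein's identity for p = 1.\<close>

lemma integral_cheb: "(\<integral>y. poly (cheb n) (Re (y $ 1 $ 1)) \<partial>\<mu>) = (if n = 0 then 1 else 0)"
proof (induction n rule: cheb.induct)
  case 1
  then show ?case by (simp add: prob_space)
next
  case 2
  then show ?case using stein_identity[of 1] by (simp add: pderiv_1)
next
  case (3 n)
  let ?U = "\<lambda>j y. poly (cheb j) (Re (y $ 1 $ 1))"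
  \<comment> \<open>\<open>poly_cheb_pderiv\<close> removes the derivative and
    \<open>2 u U_(n+1) = U_(n+2) + U_n\<close> the factor u.\<close>
  have "3 * u * poly (cheb (Suc n)) u - (1 - u\<^sup>2) * poly (pderiv (cheb (Suc n))) u
      = (real n + 4) / 2 * poly (cheb (Suc (Suc n))) u - real n / 2 * poly (cheb n) u" for u
    unfolding poly_cheb_pderiv poly_cheb_Suc_Suc by (simp add: field_simps)
  with stein_identity[of "cheb (Suc n)"]
  have "(\<integral>y. (real n + 4) / 2 * ?U (Suc (Suc n)) y - real n / 2 * ?U n y \<partial>\<mu>) = 0" by simp
  then have "(real n + 4) / 2 * (\<integral>y. ?U (Suc (Suc n)) y \<partial>\<mu>) = real n / 2 * (\<integral>y. ?U n y \<partial>\<mu>)"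
    by (simp add: integrable_poly_entry)
  also have "\<dots> = 0" using 3 by (cases n) auto
  finally show ?case by simp
qed

end

section \<open>Hoelder bounds for the oscillating functions\<close>

text \<open>The angle is the geodesic distance from the identity on the 3-sphere, so two angles
  differ by at most the geodesic distance of p and q; the claim compares the corresponding
  chords.\<close>

lemma SU2_angle_dist_le:
  assumes "p \<in> SU2" "q \<in> SU2"
  shows "2 * \<bar>sin ((arccos (Re (p $ 1 $ 1)) - arccos (Re (q $ 1 $ 1))) / 2)\<bar> \<le> SU2_dist p q"
proof -
  obtain a b where p: "p = quat a b" "(cmod a)\<^sup>2 + (cmod b)\<^sup>2 = 1"
    using assms(1) SU2_iff by blast
  obtain c d where q: "q = quat c d" "(cmod c)\<^sup>2 + (cmod d)\<^sup>2 = 1"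
    using assms(2) SU2_iff by blast
  define s t where "s = arccos (Re a)" and "t = arccos (Re c)"
  have cs: "cos s = Re a" "cos t = Re c"
    using SU2_eigenvalues(1)[OF assms(1)] SU2_eigenvalues(1)[OF assms(2)] p q
    by (simp_all add: s_def t_def cos_arccos_abs)
  have "s \<ge> 0" "s \<le> pi" "t \<ge> 0" "t \<le> pi"
    using SU2_eigenvalues(1)[OF assms(1)] SU2_eigenvalues(1)[OF assms(2)] p q
    by (auto simp: s_def t_def abs_le_iff intro!: arccos_lbound arccos_ubound)
  then have sn: "sin s \<ge> 0" "sin t \<ge> 0" by (simp_all add: sin_ge_zero)
  have s2: "(sin s)\<^sup>2 = (Im a)\<^sup>2 + (Re b)\<^sup>2 + (Im b)\<^sup>2"
    using p(2) sin_cos_squared_add[of s] unfolding cs cmod_power2 by linarith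
  have t2: "(sin t)\<^sup>2 = (Im c)\<^sup>2 + (Re d)\<^sup>2 + (Im d)\<^sup>2"
    using q(2) sin_cos_squared_add[of t] unfolding cs cmod_power2 by linarith
  \<comment> \<open>Lagrange's identity for the imaginary parts, vectors of length
    \<open>sin s\<close> and \<open>sin t\<close> in three-space; it yields Cauchy-Schwarz.\<close>
  have "(sin s * sin t)\<^sup>2 - (Im a * Im c + Re b * Re d + Im b * Im d)\<^sup>2
      = (Im a * Re d - Re b * Im c)\<^sup>2 + (Im a * Im d - Im b * Im c)\<^sup>2 + (Re b * Im d - Im b * Re d)\<^sup>2"
    unfolding power_mult_distrib s2 t2 by (simp add: power2_eq_square algebra_simps)
  also have "\<dots> \<ge> 0" by simp
  finally have "(Im a * Im c + Re b * Re d + Im b * Im d)\<^sup>2 \<le> (sin s * sin t)\<^sup>2"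
    by (simp only: diff_ge_0_iff_ge)
  then have "Im a * Im c + Re b * Re d + Im b * Im d \<le> sin s * sin t"
    by (rule power2_le_imp_le) (rule mult_nonneg_nonneg[OF sn])
  moreover have "(cmod (a - c))\<^sup>2 + (cmod (b - d))\<^sup>2
      = 2 - 2 * (Re a * Re c) - 2 * (Im a * Im c + Re b * Re d + Im b * Im d)"
    using p(2) q(2) unfolding cmod_power2 by (simp add: power2_eq_square algebra_simps)
  ultimately have "2 - 2 * cos (s - t) \<le> (cmod (a - c))\<^sup>2 + (cmod (b - d))\<^sup>2"
    unfolding cos_diff cs by argo
  moreover have "2 - 2 * cos (s - t) = (2 * \<bar>sin ((s - t) / 2)\<bar>)\<^sup>2"
  proof -
    have "2 * ((s - t) / 2) = s - t" by argo
    then have "cos (s - t) = 1 - 2 * (sin ((s - t) / 2))\<^sup>2"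
      using cos_double_sin[of "(s - t) / 2"] by (simp only:)
    then show ?thesis by (simp add: power_mult_distrib)
  qed
  ultimately have "2 * \<bar>sin ((s - t) / 2)\<bar> \<le> sqrt ((cmod (a - c))\<^sup>2 + (cmod (b - d))\<^sup>2)"
    by (intro real_le_rsqrt) simp
  then show ?thesis by (simp add: p(1) q(1) SU2_dist_quat s_def t_def)
qed

text \<open>Extracts the factor m while keeping the sine, which is the quantity that
  \<open>SU2_angle_dist_le\<close> bounds.\<close>

lemma abs_sin_nat_mult_le: "\<bar>sin (real m * t)\<bar> \<le> real m * \<bar>sin t\<bar>"
proof (induction m)
  case (Suc m)
  have "\<bar>sin (real (Suc m) * t)\<bar> = \<bar>sin (real m * t) * cos t + cos (real m * t) * sin t\<bar>"
    by (simp add: distrib_right sin_add algebra_simps)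
  also have "\<dots> \<le> \<bar>sin (real m * t)\<bar> * \<bar>cos t\<bar> + \<bar>cos (real m * t)\<bar> * \<bar>sin t\<bar>"
    by (simp add: abs_mult[symmetric] abs_triangle_ineq)
  also have "\<dots> \<le> \<bar>sin (real m * t)\<bar> * 1 + 1 * \<bar>sin t\<bar>"
    by (intro add_mono mult_mono) auto
  finally show ?case using Suc by (simp add: algebra_simps)
qed simp

text \<open>Lets the centre x of \<open>osc k x\<close> be moved to the identity; g cancels against
  its conjugate transpose inside the trace.\<close>

lemma SU2_dist_right_mult:
  assumes "g \<in> SU2"
  shows "SU2_dist (z ** g) (w ** g) = SU2_dist z w"
proof -
  have "z ** g - w ** g = (z - w) ** g"
    by (simp add: matrix_matrix_mult_def vec_eq_iff sum_subtractf left_diff_distrib)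
  then have "(z ** g - w ** g) ** conj_transpose (z ** g - w ** g)
      = (z - w) ** (g ** conj_transpose g) ** conj_transpose (z - w)"
    by (simp only: conj_transpose_mult matrix_mul_assoc)
  then show ?thesis by (simp add: SU2_dist_def SU2_conj_transpose(3)[OF assms])
qed

text \<open>On \<open>SU2\<close> this is \<open>2 cos ((k + 2) \<theta>)\<close>, where \<open>\<theta>\<close> is the angle of \<open>z x\<^sup>-\<^sup>1\<close>.\<close>

definition osc :: "nat \<Rightarrow> complex^2^2 \<Rightarrow> complex^2^2 \<Rightarrow> real" where
  "osc k x z = poly (cheb (Suc (Suc k)) - cheb k) (Re ((z ** conj_transpose x) $ 1 $ 1))"

lemma osc_eq_cos:
  assumes "x \<in> SU2" "z \<in> SU2"
  shows "osc k x z = 2 * cos (real (k + 2) * arccos (Re ((z ** conj_transpose x) $ 1 $ 1)))"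
proof -
  have "\<bar>Re ((z ** conj_transpose x) $ 1 $ 1)\<bar> \<le> 1"
    using assms by (intro SU2_eigenvalues(1) SU2_mult SU2_conj_transpose)
  then show ?thesis
    unfolding osc_def poly_cheb_diff_cos[symmetric] by (simp add: cos_arccos_abs)
qed

lemma abs_osc_le:
  assumes "x \<in> SU2" "z \<in> SU2"
  shows "\<bar>osc k x z\<bar> \<le> 2"
  unfolding osc_eq_cos[OF assms] abs_mult using abs_cos_le_one by simp

text \<open>Interpolates between the Lipschitz bound 2 v, where v is k + 2 times the distance, and
  the bound 4 from the supremum norm; both regimes v \<le> 1 and v > 1 give
  \<open>4 * v powr \<alpha>\<close>.\<close>

lemma osc_holder:
  assumes "x \<in> SU2" "z \<in> SU2" "w \<in> SU2" and "0 < \<alpha>" "\<alpha> \<le> 1"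
  shows "\<bar>osc k x z - osc k x w\<bar> \<le> 4 * (real k + 2) powr \<alpha> * SU2_dist z w powr \<alpha>"
proof -
  define m where "m = k + 2"
  define s t where "s = arccos (Re ((z ** conj_transpose x) $ 1 $ 1))"
    and "t = arccos (Re ((w ** conj_transpose x) $ 1 $ 1))"
  note x' = SU2_conj_transpose(1)[OF assms(1)]
  have d: "2 * \<bar>sin ((t - s) / 2)\<bar> \<le> SU2_dist z w"
  proof -
    have "(t - s) / 2 = - ((s - t) / 2)" by (metis minus_diff_eq minus_divide_left)
    then have "\<bar>sin ((t - s) / 2)\<bar> = \<bar>sin ((s - t) / 2)\<bar>" by (simp only: sin_minus abs_minus_cancel)
    then show ?thesis
      using SU2_angle_dist_le[OF SU2_mult[OF assms(2) x'] SU2_mult[OF assms(3) x']]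
      unfolding SU2_dist_right_mult[OF x'] s_def t_def by simp
  qed
  define v where "v = real m * SU2_dist z w"
  have d0: "0 \<le> SU2_dist z w" by (rule order_trans[OF _ d]) simp
  then have v0: "0 \<le> v" by (simp add: v_def)
  have diff: "osc k x z - osc k x w = 2 * (cos (real m * s) - cos (real m * t))"
    using assms by (simp add: osc_eq_cos s_def t_def m_def algebra_simps)
  have "\<bar>osc k x z - osc k x w\<bar> = 4 * (\<bar>sin ((real m * s + real m * t) / 2)\<bar> * \<bar>sin (real m * ((t - s) / 2))\<bar>)"
    unfolding diff cos_diff_cos abs_mult by (simp add: algebra_simps)
  also have "\<dots> \<le> 4 * (1 * (real m * \<bar>sin ((t - s) / 2)\<bar>))"
    by (intro mult_left_mono mult_mono abs_sin_nat_mult_le) auto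
  also have "\<dots> \<le> 2 * v" using mult_left_mono[OF d, of "real m"] by (simp add: v_def)
  finally have 1: "\<bar>osc k x z - osc k x w\<bar> \<le> 2 * v" .
  have 2: "\<bar>osc k x z - osc k x w\<bar> \<le> 4"
    using abs_osc_le[OF assms(1,2), of k] abs_osc_le[OF assms(1,3), of k] by linarith
  have "\<bar>osc k x z - osc k x w\<bar> \<le> 4 * v powr \<alpha>"
  proof (cases "v \<le> 1")
    case True
    then have "v powr 1 \<le> v powr \<alpha>" using v0 assms(5) by (intro powr_mono') auto
    with v0 have "v \<le> v powr \<alpha>" by simp
    with 1 v0 show ?thesis by linarith
  next
    case False
    then have "1 \<le> v powr \<alpha>" using assms(4) by (intro ge_one_powr_ge_zero) auto
    with 2 show ?thesis by linarith
  qed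
  also have "\<dots> = 4 * (real k + 2) powr \<alpha> * SU2_dist z w powr \<alpha>"
    using d0 by (simp add: v_def powr_mult m_def add.commute)
  finally show ?thesis .
qed

section \<open>Partial sums as functionals on bounded functions\<close>

context haar_SU2
begin

text \<open>Contains every \<open>osc k x\<close> and the final function. All integrals in the
  partial sums exist on it, so none takes the default value 0.\<close>

definition bounded_borel :: "(complex^2^2 \<Rightarrow> real) set" where
  "bounded_borel = {f \<in> borel_measurable \<mu>. \<exists>B. \<forall>y\<in>SU2. \<bar>f y\<bar> \<le> B}"

lemma bounded_borel_add_mult:
  assumes "f \<in> bounded_borel" "g \<in> bounded_borel"
  shows "(\<lambda>y. f y + c * g y) \<in> bounded_borel"
proof -
  obtain A B where A: "\<And>y. y \<in> SU2 \<Longrightarrow> \<bar>f y\<bar> \<le> A" and B: "\<And>y. y \<in> SU2 \<Longrightarrow> \<bar>g y\<bar> \<le> B"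
    using assms by (auto simp: bounded_borel_def)
  have "\<bar>f y + c * g y\<bar> \<le> A + \<bar>c\<bar> * B" if "y \<in> SU2" for y
    using A[OF that] mult_left_mono[OF B[OF that], of "\<bar>c\<bar>"] abs_triangle_ineq[of "f y" "c * g y"]
    by (simp add: abs_mult)
  then show ?thesis using assms by (auto simp: bounded_borel_def)
qed

lemma osc_bounded_borel:
  assumes "x \<in> SU2"
  shows "osc k x \<in> bounded_borel"
proof -
  have "osc k x \<in> borel_measurable \<mu>"
    unfolding osc_def[abs_def] by (intro borel_measurable_continuous_on_SU2 continuous_intros)
  then show ?thesis using abs_osc_le[OF assms] by (auto simp: bounded_borel_def)
qed

lemma integrable_convolution:
  assumes "f \<in> bounded_borel" "x \<in> SU2"
  shows "integrable \<mu> (\<lambda>y. poly (cheb n) (Re (y $ 1 $ 1)) * f (conj_transpose y ** x))"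
proof -
  obtain B where B: "\<And>y. y \<in> SU2 \<Longrightarrow> \<bar>f y\<bar> \<le> B" using assms by (auto simp: bounded_borel_def)
  have "(\<lambda>y. conj_transpose y ** x) \<in> measurable \<mu> \<mu>"
    using assms(2) by (intro measurable_continuous_SU2 continuous_intros SU2_mult SU2_conj_transpose)
  then have f: "(\<lambda>y. f (conj_transpose y ** x)) \<in> borel_measurable \<mu>"
    using assms(1) by (auto simp: bounded_borel_def intro: measurable_compose)
  show ?thesis
  proof (rule Bochner_Integration.integrable_bound)
    show "integrable \<mu> (\<lambda>y. B * poly (cheb n) (Re (y $ 1 $ 1)))"
      using integrable_poly_entry by simp
    show "AE y in \<mu>. norm (poly (cheb n) (Re (y $ 1 $ 1)) * f (conj_transpose y ** x))
        \<le> norm (B * poly (cheb n) (Re (y $ 1 $ 1)))"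
    proof (rule AE_I2)
      fix y assume "y \<in> space \<mu>"
      then have "\<bar>f (conj_transpose y ** x)\<bar> \<le> B"
        using assms(2) by (intro B SU2_mult SU2_conj_transpose) (auto simp: space_haar)
      then show "norm (poly (cheb n) (Re (y $ 1 $ 1)) * f (conj_transpose y ** x))
        \<le> norm (B * poly (cheb n) (Re (y $ 1 $ 1)))"
        by (auto simp: abs_mult mult.commute intro!: mult_right_mono)
    qed
  qed (use f borel_measurable_integrable[OF integrable_poly_entry] in auto)
qed

lemma partial_sum_eq:
  assumes "x \<in> SU2"
  shows "partial_sum \<mu> N f x
    = (\<Sum>n=0..N. (real n + 1) * (\<integral>y. poly (cheb n) (Re (y $ 1 $ 1)) * f (conj_transpose y ** x) \<partial>\<mu>))"
  unfolding partial_sum_def convolution_def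
  by (intro sum.cong refl arg_cong2[of _ _ _ _ "(*)"] Bochner_Integration.integral_cong)
     (simp_all add: space_haar SU2_character_eq SU2_conj_transpose(4))

lemma partial_sum_add_mult:
  assumes "x \<in> SU2" "f \<in> bounded_borel" "g \<in> bounded_borel"
  shows "partial_sum \<mu> N (\<lambda>y. f y + c * g y) x = partial_sum \<mu> N f x + c * partial_sum \<mu> N g x"
proof -
  let ?I = "\<lambda>n f. \<integral>y. poly (cheb n) (Re (y $ 1 $ 1)) * f (conj_transpose y ** x) \<partial>\<mu>"
  have "?I n (\<lambda>y. f y + c * g y) = ?I n f + c * ?I n g" for n
  proof -
    have "?I n (\<lambda>y. f y + c * g y)
        = (\<integral>y. poly (cheb n) (Re (y $ 1 $ 1)) * f (conj_transpose y ** x)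
            + c * (poly (cheb n) (Re (y $ 1 $ 1)) * g (conj_transpose y ** x)) \<partial>\<mu>)"
      by (simp add: algebra_simps)
    then show ?thesis
      using integrable_convolution[OF assms(2,1), of n] integrable_convolution[OF assms(3,1), of n] by simp
  qed
  then show ?thesis
    by (simp add: partial_sum_eq[OF assms(1)] sum.distrib distrib_left sum_distrib_left
        mult.left_commute)
qed

text \<open>A bound, uniform in x, for the norm of \<open>f \<mapsto> S_N f x\<close> in the
  supremum norm, built from the L^1 norms of the characters. Its summands are nonnegative, so it is
  monotone in N; the 1 keeps it positive for divisions.\<close>

definition partial_sum_bound :: "nat \<Rightarrow> real" where
  "partial_sum_bound N = 1 + (\<Sum>n=0..N. (real n + 1) * (\<integral>y. \<bar>poly (cheb n) (Re (y $ 1 $ 1))\<bar> \<partial>\<mu>))"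

lemma mono_partial_sum_bound: "mono partial_sum_bound"
  unfolding partial_sum_bound_def by (intro monoI add_left_mono sum_mono2) auto

lemma partial_sum_bound_pos: "partial_sum_bound N > 0"
  unfolding partial_sum_bound_def by (intro add_pos_nonneg sum_nonneg) auto

lemma abs_partial_sum_le:
  assumes "x \<in> SU2" "f \<in> bounded_borel" "\<And>y. y \<in> SU2 \<Longrightarrow> \<bar>f y\<bar> \<le> B"
  shows "\<bar>partial_sum \<mu> N f x\<bar> \<le> partial_sum_bound N * B"
proof -
  let ?U = "\<lambda>n y. poly (cheb n) (Re (y $ 1 $ 1))"
  have B: "0 \<le> B" using assms(3)[OF assms(1)] by linarith
  have I: "\<bar>\<integral>y. ?U n y * f (conj_transpose y ** x) \<partial>\<mu>\<bar> \<le> (\<integral>y. \<bar>?U n y\<bar> \<partial>\<mu>) * B" for n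
  proof -
    have "\<bar>\<integral>y. ?U n y * f (conj_transpose y ** x) \<partial>\<mu>\<bar> \<le> (\<integral>y. \<bar>?U n y * f (conj_transpose y ** x)\<bar> \<partial>\<mu>)"
      by (rule integral_abs_bound)
    also have "\<dots> \<le> (\<integral>y. \<bar>?U n y\<bar> * B \<partial>\<mu>)"
    proof (rule integral_mono)
      show "integrable \<mu> (\<lambda>y. \<bar>?U n y * f (conj_transpose y ** x)\<bar>)"
        by (rule integrable_abs[OF integrable_convolution[OF assms(2,1)]])
      show "integrable \<mu> (\<lambda>y. \<bar>?U n y\<bar> * B)"
        by (rule integrable_mult_left[OF integrable_abs[OF integrable_poly_entry]])
      fix y assume "y \<in> space \<mu>"
      then have "conj_transpose y ** x \<in> SU2"
        by (intro SU2_mult SU2_conj_transpose assms(1)) (simp add: space_haar)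
      then show "\<bar>?U n y * f (conj_transpose y ** x)\<bar> \<le> \<bar>?U n y\<bar> * B"
        unfolding abs_mult by (intro mult_left_mono assms(3)) auto
    qed
    finally show ?thesis by simp
  qed
  have "\<bar>partial_sum \<mu> N f x\<bar> \<le> (\<Sum>n=0..N. \<bar>(real n + 1) * (\<integral>y. ?U n y * f (conj_transpose y ** x) \<partial>\<mu>)\<bar>)"
    unfolding partial_sum_eq[OF assms(1)] by (rule sum_abs)
  also have "\<dots> \<le> (\<Sum>n=0..N. (real n + 1) * ((\<integral>y. \<bar>?U n y\<bar> \<partial>\<mu>) * B))"
    using I by (intro sum_mono) (auto simp: abs_mult intro!: mult_left_mono)
  also have "\<dots> \<le> partial_sum_bound N * B"
    using B by (simp add: partial_sum_bound_def distrib_right sum_distrib_right mult.assoc)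
  finally show ?thesis .
qed

text \<open>Only n = k contributes: -1 from \<open>cheb 0\<close> in the product formula, with
  weight k + 1. The cut at k + 1 excludes degree k + 2, which would add k + 3 and nearly cancel
  this.\<close>

lemma partial_sum_osc:
  assumes "x \<in> SU2"
  shows "partial_sum \<mu> (Suc k) (osc k x) x = - (real k + 1)"
proof -
  let ?I = "\<lambda>n. \<integral>y. poly (cheb n) (Re (y $ 1 $ 1)) * osc k x (conj_transpose y ** x) \<partial>\<mu>"
  \<comment> \<open>After x cancels, the argument is the conjugate transpose of y, which has the
    same real part in its corner entry.\<close>
  have osc: "osc k x (conj_transpose y ** x) = poly (cheb (Suc (Suc k)) - cheb k) (Re (y $ 1 $ 1))" for y
    unfolding osc_def by (simp add: matrix_mul_assoc[symmetric] SU2_conj_transpose(3)[OF assms])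
      (simp add: conj_transpose_def)
  have low: "?I n = (if n = k then - 1 else 0)" if "n \<le> k" for n
  proof -
    have "?I n = (\<integral>y. poly (cheb (n + k + 2)) (Re (y $ 1 $ 1)) - poly (cheb (k - n)) (Re (y $ 1 $ 1)) \<partial>\<mu>)"
      unfolding osc poly_cheb_mult[OF that, symmetric] by (simp only: mult.commute)
    also have "\<dots> = (if n = k then - 1 else 0)"
      using that by (simp add: Bochner_Integration.integral_diff[OF integrable_poly_entry integrable_poly_entry] integral_cheb)
    finally show ?thesis .
  qed
  have "?I (Suc k) = (\<integral>y. poly (cheb (2 * k + 3)) (Re (y $ 1 $ 1)) \<partial>\<mu>)"
    unfolding osc poly_cheb_mult_Suc[symmetric] by (simp only: mult.commute)
  also have "\<dots> = 0" by (simp add: integral_cheb)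
  finally have top: "?I (Suc k) = 0" .
  have "partial_sum \<mu> (Suc k) (osc k x) x
      = (\<Sum>n=0..k. (real n + 1) * ?I n) + (real (Suc k) + 1) * ?I (Suc k)"
    unfolding partial_sum_eq[OF assms] by (simp add: sum.atLeast0_atMost_Suc)
  also have "(\<Sum>n=0..k. (real n + 1) * ?I n) = (\<Sum>n=0..k. if n = k then - (real n + 1) else 0)"
    by (intro sum.cong refl) (simp add: low)
  also have "\<dots> = - (real k + 1)" by simp
  finally show ?thesis by (simp only: top)
qed

section \<open>The gliding hump\<close>

text \<open>The sign makes the new term increase the modulus whatever the partial sum of \<open>F\<close> is, so no
  bound on the partial sums of the terms chosen earlier is needed.\<close>

lemma gliding_hump_step:
  assumes "F \<in> bounded_borel" "x \<in> SU2" "0 < \<alpha>" "\<alpha> < 1"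
  obtains k' s where "k < k'" "\<bar>s\<bar> = 1"
    "partial_sum_bound (Suc k) * (real k' + 2) powr - \<alpha> \<le> 1"
    "real j \<le> \<bar>partial_sum \<mu> (Suc k') (\<lambda>z. F z + s * (1 / 2) ^ j * (real k' + 2) powr - \<alpha> * osc k' x z) x\<bar>"
proof -
  \<comment> \<open>A high frequency k' makes the new term harmless to the partial sums up to k + 1;
    this uses \<alpha> > 0.\<close>
  have "((\<lambda>k'. partial_sum_bound (Suc k) * (real k' + 2) powr - \<alpha>) \<longlongrightarrow> 0) at_top"
    using assms(3) by real_asymp
  then have "eventually (\<lambda>k'. partial_sum_bound (Suc k) * (real k' + 2) powr - \<alpha> < 1) at_top"
    by (rule order_tendstoD) simp
  \<comment> \<open>With j fixed, the new term's own partial sum grows like k' to the power 1 -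
    \<alpha>; this uses \<alpha> < 1.\<close>
  moreover have "filterlim (\<lambda>k'. (1 / 2) ^ j * (real k' + 2) powr - \<alpha> * (real k' + 1)) at_top at_top"
    using assms(3,4) by real_asymp
  then have "eventually (\<lambda>k'. real j \<le> (1 / 2) ^ j * (real k' + 2) powr - \<alpha> * (real k' + 1)) at_top"
    by (auto simp: filterlim_at_top)
  ultimately have ev: "eventually (\<lambda>k'. k < k' \<and> partial_sum_bound (Suc k) * (real k' + 2) powr - \<alpha> < 1
      \<and> real j \<le> (1 / 2) ^ j * (real k' + 2) powr - \<alpha> * (real k' + 1)) at_top"
    using eventually_gt_at_top[of k] by eventually_elim auto
  obtain k' where k': "k < k'" "partial_sum_bound (Suc k) * (real k' + 2) powr - \<alpha> < 1"
      "real j \<le> (1 / 2) ^ j * (real k' + 2) powr - \<alpha> * (real k' + 1)"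
    using eventually_happens'[OF sequentially_bot ev] by blast
  define c where "c = (1 / 2) ^ j * (real k' + 2) powr - \<alpha>"
  \<comment> \<open>By \<open>partial_sum_osc\<close> the new term contributes -s times a
    nonnegative number, so s is taken opposite in sign to the partial sum of F.\<close>
  define s where "s = (if partial_sum \<mu> (Suc k') F x \<ge> 0 then - 1 else 1 :: real)"
  have "partial_sum \<mu> (Suc k') (\<lambda>z. F z + s * c * osc k' x z) x
      = partial_sum \<mu> (Suc k') F x - s * (c * (real k' + 1))"
    unfolding partial_sum_add_mult[OF assms(2,1) osc_bounded_borel[OF assms(2)]] partial_sum_osc[OF assms(2)]
    by (simp add: algebra_simps)
  moreover have "0 \<le> c * (real k' + 1)" by (simp add: c_def)
  ultimately have "c * (real k' + 1) \<le> \<bar>partial_sum \<mu> (Suc k') (\<lambda>z. F z + s * c * osc k' x z) x\<bar>"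
    by (auto simp: s_def)
  with k' show thesis
    by (intro that[of k' s]) (auto simp: s_def c_def mult.assoc)
qed

lemma ex_Lip_divergent:
  fixes x :: "nat \<Rightarrow> complex^2^2"
  assumes "0 < \<alpha>" "\<alpha> < 1" and x: "\<And>i. x i \<in> SU2"
  shows "\<exists>f\<in>Lip \<alpha>. \<forall>i. (SUP N\<in>{1..}. ereal \<bar>partial_sum \<mu> N f (x i)\<bar>) = \<infinity>"
proof -
  \<comment> \<open>Decoding pairs makes every index i recur at infinitely many stages j.\<close>
  define X where "X = (\<lambda>j. x (fst (prod_decode j)))"
  have X: "X j \<in> SU2" for j by (simp add: X_def x)
  define a where "a = (\<lambda>k. (real k + 2) powr - \<alpha>)"
  \<comment> \<open>A state (k, F) holds the last frequency used and the sum of the terms chosen so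
    far.\<close>
  define Q where "Q = (\<lambda>(j::nat) (k, F) (k', F'). \<exists>s::real. k < k' \<and> \<bar>s\<bar> = 1 \<and>
      partial_sum_bound (Suc k) * a k' \<le> 1 \<and> F' = (\<lambda>z. F z + s * (1 / 2) ^ j * a k' * osc k' (X j) z) \<and>
      real j \<le> \<bar>partial_sum \<mu> (Suc k') F' (X j)\<bar>)"
  \<comment> \<open>The conjunct for j = 0 pins the starting function, so that \<open>F n\<close> is
    exactly the sum of the first n terms.\<close>
  have "\<exists>S. \<forall>j. (snd (S j) \<in> bounded_borel \<and> (j = 0 \<longrightarrow> snd (S j) = (\<lambda>_. 0))) \<and> Q j (S j) (S (Suc j))"
  proof (rule dependent_nat_choice)
    show "\<exists>S::nat \<times> _. snd S \<in> bounded_borel \<and> (0 = 0 \<longrightarrow> snd S = (\<lambda>_. 0))"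
      by (intro exI[of _ "(0, \<lambda>_. 0)"]) (auto simp: bounded_borel_def)
  next
    fix S :: "nat \<times> (complex^2^2 \<Rightarrow> real)" and j :: nat
    assume S: "snd S \<in> bounded_borel \<and> (j = 0 \<longrightarrow> snd S = (\<lambda>_. 0))"
    obtain k F where kF: "S = (k, F)" by (cases S)
    then have F: "F \<in> bounded_borel" using S by simp
    obtain k' s where "k < k'" "\<bar>s\<bar> = 1" "partial_sum_bound (Suc k) * a k' \<le> 1"
      "real j \<le> \<bar>partial_sum \<mu> (Suc k') (\<lambda>z. F z + s * (1 / 2) ^ j * a k' * osc k' (X j) z) (X j)\<bar>"
      unfolding a_def
      by (rule gliding_hump_step[where k = k and j = j, OF F X assms(1,2)]) blast
    then have "Q j S (k', \<lambda>z. F z + s * (1 / 2) ^ j * a k' * osc k' (X j) z)"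
      unfolding Q_def kF by auto
    moreover have "(\<lambda>z. F z + s * (1 / 2) ^ j * a k' * osc k' (X j) z) \<in> bounded_borel"
      by (rule bounded_borel_add_mult[OF F osc_bounded_borel[OF X]])
    ultimately show "\<exists>S'. (snd S' \<in> bounded_borel \<and> (Suc j = 0 \<longrightarrow> snd S' = (\<lambda>_. 0))) \<and> Q j S S'"
      by (intro exI[of _ "(k', \<lambda>z. F z + s * (1 / 2) ^ j * a k' * osc k' (X j) z)"]) auto
  qed
  then obtain S where S: "\<And>j. snd (S j) \<in> bounded_borel" "snd (S 0) = (\<lambda>_. 0)" "\<And>j. Q j (S j) (S (Suc j))"
    by blast
  define k F where "k = (\<lambda>j. fst (S j))" and "F = (\<lambda>j. snd (S j))"
  have "\<forall>j. \<exists>s. k j < k (Suc j) \<and> \<bar>s\<bar> = 1 \<and> partial_sum_bound (Suc (k j)) * a (k (Suc j)) \<le> 1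
      \<and> F (Suc j) = (\<lambda>z. F j z + s * (1 / 2) ^ j * a (k (Suc j)) * osc (k (Suc j)) (X j) z)
      \<and> real j \<le> \<bar>partial_sum \<mu> (Suc (k (Suc j))) (F (Suc j)) (X j)\<bar>"
    using S(3) unfolding Q_def k_def F_def by (simp add: case_prod_unfold)
  then obtain s where k_less: "\<And>j. k j < k (Suc j)" and s: "\<And>j. \<bar>s j\<bar> = 1"
    and a_le: "\<And>j. partial_sum_bound (Suc (k j)) * a (k (Suc j)) \<le> 1"
    and F_Suc: "\<And>j. F (Suc j) = (\<lambda>z. F j z + s j * (1 / 2) ^ j * a (k (Suc j)) * osc (k (Suc j)) (X j) z)"
    and large: "\<And>j. real j \<le> \<bar>partial_sum \<mu> (Suc (k (Suc j))) (F (Suc j)) (X j)\<bar>"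
    by metis
  define b where "b = (\<lambda>j z. s j * (1 / 2) ^ j * a (k (Suc j)) * osc (k (Suc j)) (X j) z)"
  have F_sum: "F n z = (\<Sum>j<n. b j z)" for n z
    using S(2) by (induction n) (simp_all add: F_Suc b_def, simp add: F_def)
  have F_bb: "F n \<in> bounded_borel" for n using S(1) by (simp add: F_def)
  have a_pos: "0 < a n" and a_le_1: "a n \<le> 1" for n
    using assms(1) powr_mono[of "- \<alpha>" 0 "real n + 2"] by (simp_all add: a_def)
  have b_le: "\<bar>b j z\<bar> \<le> 2 * (1 / 2) ^ j * a (k (Suc j))" if "z \<in> SU2" for j z
    using mult_left_mono[OF abs_osc_le[OF X that], of "(1 / 2) ^ j * a (k (Suc j))"] a_pos
    by (simp add: b_def abs_mult s less_imp_le algebra_simps)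
  have geo: "(\<lambda>j. c * (1 / 2) ^ j) sums (2 * c)" for c :: real
    using sums_mult[OF geometric_sums[of "1 / 2 :: real"], of c] by (simp add: mult.commute)
  have b_summable: "summable (\<lambda>j. b j z)" if z: "z \<in> SU2" for z
  proof (rule summable_comparison_test'[of "\<lambda>j. 2 * (1 / 2) ^ j" 0])
    show "summable (\<lambda>j. 2 * (1 / 2) ^ j :: real)" using geo[of 2] by (rule sums_summable)
    show "norm (b j z) \<le> 2 * (1 / 2) ^ j" for j
      using order_trans[OF b_le[OF z, of j] mult_left_le[OF a_le_1]] by simp
  qed
  define f where "f = (\<lambda>z. \<Sum>j. b j z)"
  have "f \<in> Lip \<alpha>"
    unfolding Lip_def
  \<comment> \<open>The weight \<open>a\<close> cancels the growth of the Hoelder constant in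
    \<open>osc_holder\<close>, leaving 4 / 2^j for term j; these sum to 8.\<close>
  proof (intro CollectI exI[of _ 8] conjI ballI)
    fix z w assume z: "z \<in> SU2" and w: "w \<in> SU2"
    let ?d = "SU2_dist z w powr \<alpha>"
    have le: "norm (b j z - b j w) \<le> (4 * ?d) * (1 / 2) ^ j" for j
    proof -
      let ?c = "(1 / 2) ^ j * a (k (Suc j))" and ?o = "osc (k (Suc j)) (X j)"
      have "norm (b j z - b j w) = ?c * \<bar>?o z - ?o w\<bar>"
        using a_pos[of "k (Suc j)"]
        by (simp add: b_def right_diff_distrib[symmetric] abs_mult s less_imp_le)
      also have "\<dots> \<le> ?c * (4 * (real (k (Suc j)) + 2) powr \<alpha> * ?d)"
        using assms a_pos[of "k (Suc j)"] by (intro mult_left_mono osc_holder X z w) auto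
      also have "\<dots> = (a (k (Suc j)) * (real (k (Suc j)) + 2) powr \<alpha>) * ((4 * ?d) * (1 / 2) ^ j)"
        by (simp only: mult_ac)
      also have "a (k (Suc j)) * (real (k (Suc j)) + 2) powr \<alpha> = 1"
        by (simp add: a_def powr_add[symmetric])
      finally show ?thesis by simp
    qed
    have "f z - f w = (\<Sum>j. b j z - b j w)"
      unfolding f_def by (rule suminf_diff[OF b_summable[OF z] b_summable[OF w]])
    moreover have "norm (\<Sum>j. b j z - b j w) \<le> (\<Sum>j. (4 * ?d) * (1 / 2) ^ j)"
      by (rule norm_suminf_le[OF le sums_summable[OF geo]])
    ultimately show "\<bar>f z - f w\<bar> \<le> 8 * ?d" using sums_unique[OF geo, of "4 * ?d"] by simp
  qed simp
  \<comment> \<open>At each later stage \<open>a_le\<close> bounds the weight by the reciprocal of a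
    norm bound that, by monotonicity, is at least the one at \<open>k n\<close>. The geometric
    series turns 2 into 4.\<close>
  have tail: "\<bar>f z - F n z\<bar> \<le> 4 / partial_sum_bound (Suc (k n))" if z: "z \<in> SU2" for n z
  proof -
    let ?D = "partial_sum_bound (Suc (k n))"
    have le: "norm (b (j + n) z) \<le> (2 / ?D) * (1 / 2) ^ j" for j
    proof -
      have "k n \<le> k (j + n)"
        by (rule lift_Suc_mono_le[of k, OF less_imp_le[OF k_less]]) simp
      then have "?D \<le> partial_sum_bound (Suc (k (j + n)))"
        by (intro monoD[OF mono_partial_sum_bound]) simp
      then have "?D * a (k (Suc (j + n))) \<le> partial_sum_bound (Suc (k (j + n))) * a (k (Suc (j + n)))"
        by (rule mult_right_mono[OF _ less_imp_le[OF a_pos]])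
      also have "\<dots> \<le> 1" by (rule a_le)
      finally have "a (k (Suc (j + n))) \<le> 1 / ?D"
        using partial_sum_bound_pos[of "Suc (k n)"] by (simp add: pos_le_divide_eq mult.commute)
      moreover have "(1 / 2 :: real) ^ (j + n) \<le> (1 / 2) ^ j" by (rule power_decreasing) auto
      ultimately have "2 * (1 / 2) ^ (j + n) * a (k (Suc (j + n))) \<le> 2 * (1 / 2) ^ j * (1 / ?D)"
        using a_pos[of "k (Suc (j + n))"] by (intro mult_mono) auto
      also have "\<dots> = (2 / ?D) * (1 / 2) ^ j" by simp
      finally show ?thesis using b_le[OF z, of "j + n"] by simp
    qed
    have "f z - F n z = (\<Sum>j. b (j + n) z)"
      using suminf_minus_initial_segment[OF b_summable[OF z], of n] by (simp add: f_def F_sum)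
    moreover have "norm (\<Sum>j. b (j + n) z) \<le> (\<Sum>j. (2 / ?D) * (1 / 2) ^ j)"
      by (rule norm_suminf_le[OF le sums_summable[OF geo]])
    ultimately show ?thesis using sums_unique[OF geo, of "2 / ?D"] by simp
  qed
  have f_bb: "f \<in> bounded_borel"
  proof -
    have "osc (k (Suc j)) (X j) \<in> borel_measurable \<mu>" for j
      using osc_bounded_borel[OF X] by (simp add: bounded_borel_def)
    then have "b j \<in> borel_measurable \<mu>" for j
      unfolding b_def by (rule borel_measurable_times[OF borel_measurable_const])
    then have "f \<in> borel_measurable \<mu>" unfolding f_def by (intro borel_measurable_suminf)
    \<comment> \<open>\<open>F 0\<close> is the empty sum, so the tail estimate at 0 bounds f
      itself.\<close>
    moreover have "\<bar>f z\<bar> \<le> 4 / partial_sum_bound (Suc (k 0))" if "z \<in> SU2" for z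
      using tail[OF that, of 0] by (simp add: F_sum)
    ultimately show ?thesis by (auto simp: bounded_borel_def)
  qed
  \<comment> \<open>The tail after stage j is at most 4 divided by the norm bound for this very N,
    so it changes the partial sum by at most 4.\<close>
  have big: "real j - 4 \<le> \<bar>partial_sum \<mu> (Suc (k (Suc j))) f (X j)\<bar>" for j
  proof -
    let ?N = "Suc (k (Suc j))"
    let ?r = "\<lambda>z. f z + (- 1) * F (Suc j) z"
    have "\<bar>partial_sum \<mu> ?N ?r (X j)\<bar> \<le> partial_sum_bound ?N * (4 / partial_sum_bound ?N)"
      using tail by (intro abs_partial_sum_le X bounded_borel_add_mult f_bb F_bb) auto
    also have "\<dots> = 4" using partial_sum_bound_pos[of ?N] by simp
    finally have "\<bar>partial_sum \<mu> ?N f (X j) - partial_sum \<mu> ?N (F (Suc j)) (X j)\<bar> \<le> 4"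
      unfolding partial_sum_add_mult[OF X f_bb F_bb] by simp
    with large[of j] show ?thesis by linarith
  qed
  have "(SUP N\<in>{1..}. ereal \<bar>partial_sum \<mu> N f (x i)\<bar>) = \<infinity>" for i
  proof (rule SUP_PInfty)
    fix n :: nat
    \<comment> \<open>The stage coding (i, n + 4) visits \<open>x i\<close>, and its number is at
      least n + 4, which offsets the loss of 4 in \<open>big\<close>.\<close>
    define j where "j = prod_encode (i, n + 4)"
    have "n + 4 \<le> j" unfolding j_def by (rule le_prod_encode_2)
    then have "real n \<le> real j - 4" by simp
    moreover have "X j = x i" by (simp add: X_def j_def)
    ultimately show "\<exists>N\<in>{1..}. ereal (real n) \<le> ereal \<bar>partial_sum \<mu> N f (x i)\<bar>"
      using big[of j] by (intro bexI[of _ "Suc (k (Suc j))"]) auto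
  qed
  with \<open>f \<in> Lip \<alpha>\<close> show ?thesis by blast
qed

end

theorem theorem4p1:
  fixes \<mu> :: "(complex^2^2) measure" and \<alpha> :: real and x :: "nat \<Rightarrow> complex^2^2"
  assumes "is_haar_SU2 \<mu>"
    and "0 < \<alpha>" and "\<alpha> < 1"
    and "\<And>i. i \<ge> 1 \<Longrightarrow> x i \<in> SU2"
  shows "\<exists>f\<in>Lip \<alpha>. \<forall>i\<ge>1. (SUP N\<in>{1..}. ereal \<bar>partial_sum \<mu> N f (x i)\<bar>) = \<infinity>"
proof -
  interpret haar_SU2 \<mu> using assms(1) by unfold_locales
  \<comment> \<open>The points are numbered from 1 and \<open>ex_Lip_divergent\<close> counts from
    0, hence the shift by \<open>Suc\<close>.\<close>
  obtain f where f: "f \<in> Lip \<alpha>" "\<And>i. (SUP N\<in>{1..}. ereal \<bar>partial_sum \<mu> N f (x (Suc i))\<bar>) = \<infinity>"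
    using ex_Lip_divergent[of \<alpha> "\<lambda>i. x (Suc i)"] assms by auto
  have "(SUP N\<in>{1..}. ereal \<bar>partial_sum \<mu> N f (x i)\<bar>) = \<infinity>" if "i \<ge> 1" for i
    using f(2)[of "i - 1"] that by simp
  with f(1) show ?thesis by blast
qed

end
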